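(* There exist positive constants $c',c''$ for which the following holds. Let $\mu$ be an isotropic $\psi_2$ probability measure on $\mathbb{R}^p$ with constant $\alpha\ge1$. Let $X_1,\dots,X_n\in\mathbb{R}^p$ be independent, distributed according to $\mu$, and define $\Gamma=\sum_{i=1}^n\langle X_i,\cdot\rangle e_i$ (a linear map $\mathbb{R}^p\to\mathbb{R}^n$), where $e_i\in\mathbb{R}^n$ is the vector with $i$-th entry $1$ and all other entries $0$. Then with probability at least $1-c'\exp(-c''n)$, for all $x\in\mathbb{R}^p$, $$\frac{\|x\|_2}{4}-C_\alpha\sqrt{\frac{\log p}{n}}\,\|x\|_1\le\frac{\|\Gamma x\|_2}{\sqrt n},$$ where $C_\alpha$ is a positive constant that depends only on $\alpha$.
   Context: Here $n$ and $p$ are positive integers. For a real random variable $X$, $\|X\|_{\psi_2}:=\inf\{t:\mathbb{E}\exp(X^2/t^2)\le2\}$ (infimum over $t>0$). A random vector $Y$ in $\mathbb{R}^p$ (or its law) is called isotropic if $\mathbb{E}|\langle Y,y\rangle|^2=\|y\|_2^2$ for every $y\in\mathbb{R}^p$, and is $\psi_2$ with constant $\alpha$ if $\|\langle Y,y\rangle\|_{\psi_2}\le\alpha\|y\|_2$ for every $y\in\mathbb{R}^p$.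
   Formalization: The constant c'' is allowed to depend on α (c' stays absolute), since with c'' independent of α the claim is false already for p = 1; the X_i are taken on sample spaces of one fixed type, which is enough as only their joint law matters. *)

theory Defs
  imports "HOL-Probability.Probability"
begin

text \<open>
  The constants of the theorem must be chosen before the dimensions, so \<open>\<real>\<^sup>p\<close> cannot be a type
  indexed by the dimension. A vector of \<open>\<real>\<^sup>p\<close> is a function on the index set \<open>{1..p}\<close>, extended by
  \<^const>\<open>undefined\<close>, and the Borel structure of \<open>\<real>\<^sup>p\<close> is the product sigma-algebra. The measure part of
  the product of the copies of \<^const>\<open>borel\<close> is irrelevant; only its space and sets are used.
\<close>

abbreviation Rvec :: "nat \<Rightarrow> (nat \<Rightarrow> real) measure" where
  "Rvec p \<equiv> (\<Pi>\<^sub>M j\<in>{1..p}. borel)"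

definition dotp :: "nat \<Rightarrow> (nat \<Rightarrow> real) \<Rightarrow> (nat \<Rightarrow> real) \<Rightarrow> real" where
  "dotp p x y = (\<Sum>j=1..p. x j * y j)"

definition l1_norm :: "nat \<Rightarrow> (nat \<Rightarrow> real) \<Rightarrow> real" where
  "l1_norm p x = (\<Sum>j=1..p. \<bar>x j\<bar>)"

definition l2_norm :: "nat \<Rightarrow> (nat \<Rightarrow> real) \<Rightarrow> real" where
  "l2_norm p x = L2_set x {1..p}"

definition unit_vec :: "nat \<Rightarrow> nat \<Rightarrow> (nat \<Rightarrow> real)" where
  "unit_vec n i = (\<lambda>k\<in>{1..n}. if k = i then 1 else 0)"

text \<open>
  The norm takes values in \<^typ>\<open>ennreal\<close> and uses the nonnegative integral, so that an infinite
  exponential moment never counts as at most \<open>2\<close>, and the norm is infinite if no \<open>t\<close> is admissible.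
\<close>

definition psi2_norm :: "'a measure \<Rightarrow> ('a \<Rightarrow> real) \<Rightarrow> ennreal" where
  "psi2_norm M f =
     (INF t\<in>{t::real. 0 < t \<and> (\<integral>\<^sup>+ \<omega>. ennreal (exp ((f \<omega>)\<^sup>2 / t\<^sup>2)) \<partial>M) \<le> 2}. ennreal t)"

definition isotropic :: "nat \<Rightarrow> (nat \<Rightarrow> real) measure \<Rightarrow> bool" where
  "isotropic p \<mu> \<longleftrightarrow>
     (\<forall>y\<in>space (Rvec p).
        (\<integral>\<^sup>+ z. ennreal (\<bar>dotp p z y\<bar>\<^sup>2) \<partial>\<mu>) = ennreal ((l2_norm p y)\<^sup>2))"

definition psi2_with_const :: "nat \<Rightarrow> real \<Rightarrow> (nat \<Rightarrow> real) measure \<Rightarrow> bool" where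
  "psi2_with_const p \<alpha> \<mu> \<longleftrightarrow>
     (\<forall>y\<in>space (Rvec p). psi2_norm \<mu> (\<lambda>z. dotp p z y) \<le> ennreal (\<alpha> * l2_norm p y))"

definition Gamma_map ::
  "nat \<Rightarrow> nat \<Rightarrow> (nat \<Rightarrow> nat \<Rightarrow> real) \<Rightarrow> (nat \<Rightarrow> real) \<Rightarrow> (nat \<Rightarrow> real)" where
  "Gamma_map n p X x = (\<lambda>k\<in>{1..n}. \<Sum>i=1..n. dotp p (X i) x * unit_vec n i k)"

text \<open>
  Independent copies \<open>X 1, \<dots>, X n\<close> of \<open>\<mu>\<close> on an arbitrary probability space. The type of
  sample points is left open here; a statement that quantifies over the sample space inside an
  existential must fix it, and \<open>nat \<Rightarrow> nat \<Rightarrow> real\<close> loses nothing, because the joint law of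
  \<open>X 1, \<dots>, X n\<close> on any sample space is a measure on (a subset of) that type.
\<close>

definition iid_sample ::
  "nat \<Rightarrow> nat \<Rightarrow> (nat \<Rightarrow> real) measure \<Rightarrow> 'w measure \<Rightarrow> (nat \<Rightarrow> 'w \<Rightarrow> nat \<Rightarrow> real) \<Rightarrow> bool" where
  "iid_sample n p \<mu> M X \<longleftrightarrow>
     prob_space M \<and>
     prob_space.indep_vars M (\<lambda>_. Rvec p) X {1..n} \<and>
     (\<forall>i\<in>{1..n}. distr M (Rvec p) (X i) = \<mu>)"

end

theory Submission
  imports Defs
begin

text \<open>
  Let \<open>Q(x) = |\<Gamma>x|\<^sup>2/n - |x|\<^sup>2/2\<close>, where \<open>|\<cdot>|\<close> is the Euclidean norm. For a fixed vector, \<open>Q \<ge> 0\<close> fails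
  with probability at most \<open>exp(-\<kappa>n)\<close>, \<open>\<kappa> = 1/(256\<alpha>\<^sup>4)\<close>, by the exponential moment method for lower
  tails of sums of nonnegative variables. A union bound makes \<open>Q\<close> nonnegative on all the at most
  \<open>(2p)\<^sup>m\<close> sums of \<open>m\<close> signed basis vectors, where \<open>m\<close> is of order \<open>\<kappa>n/log p\<close>. Maurey's empirical
  method transfers this to every \<open>x\<close> with \<open>\<ell>\<^sub>1\<close>-norm \<open>1\<close>: the sum of \<open>m\<close> independent random signed basis
  vectors with mean \<open>x\<close> has expected value \<open>m\<^sup>2 Q(x) + m(V - Q(x)) \<ge> 0\<close> under \<open>Q\<close>, where \<open>V\<close> is an
  average of the numbers \<open>Q(e\<^sub>j)\<close>, and these are at most \<open>8\<alpha>\<^sup>2\<close> with high probability. So \<open>Q(x)\<close> is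
  at least \<open>-16\<alpha>\<^sup>2/m\<close>, which is of order \<open>\<alpha>\<^sup>6 log p / n\<close>. If \<open>log p\<close> exceeds a multiple of \<open>\<kappa>n\<close>, the
  left-hand side of the claim is not positive, because the \<open>\<ell>\<^sub>1\<close>-norm dominates the Euclidean norm.
\<close>

section \<open>Exponential moments and tails of sums of independent variables\<close>

text \<open>The product of \<open>1 - y + y^2/2\<close> and \<open>1 + y + y^2/2\<close> is
  \<open>1 + y^4/4\<close>, so the quadratic Taylor bound for \<open>exp y\<close> from below turns
  into one for \<open>exp (- y)\<close> from above.\<close>

lemma exp_minus_le_quadratic:
  fixes y :: real
  assumes "0 \<le> y"
  shows "exp (- y) \<le> 1 - y + y\<^sup>2 / 2"
proof -
  have "1 \<le> (1 - y + y\<^sup>2 / 2) * (1 + y + y\<^sup>2 / 2)"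
    using assms by (simp add: algebra_simps power2_eq_square)
  also have "\<dots> \<le> (1 - y + y\<^sup>2 / 2) * exp y"
  proof (rule mult_left_mono)
    show "1 + y + y\<^sup>2 / 2 \<le> exp y"
      using assms by (rule exp_lower_Taylor_quadratic)
    have "0 \<le> (1 - y)\<^sup>2 + 1" by simp
    then show "0 \<le> 1 - y + y\<^sup>2 / 2"
      by (simp add: power2_eq_square algebra_simps)
  qed
  finally show ?thesis
    by (simp add: exp_minus field_simps)
qed

text \<open>The linear term of the expansion of \<open>exp (- l * W)\<close> contributes
  \<open>- l\<close> because the mean is 1. The quadratic term is absorbed by
  \<open>exp (W / b)\<close>, whose own expansion contains \<open>(W / b)^2 / 2\<close>.\<close>

lemma nn_integral_exp_minus_le:
  assumes "prob_space N" and [measurable]: "W \<in> borel_measurable N"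
    and nonneg: "\<And>z. 0 \<le> W z" and mean: "(\<integral>\<^sup>+ z. ennreal (W z) \<partial>N) = 1"
    and exp_moment: "(\<integral>\<^sup>+ z. ennreal (exp (W z / b)) \<partial>N) \<le> 2"
    and "0 < b" "0 \<le> l"
  shows "(\<integral>\<^sup>+ z. ennreal (exp (- l * W z)) \<partial>N) \<le> ennreal (exp (- l + l\<^sup>2 * b\<^sup>2))"
proof -
  interpret prob_space N by fact
  define I where "I = (\<integral>\<^sup>+ z. ennreal (exp (- l * W z)) \<partial>N)"
  \<comment> \<open>Every term is nonnegative, so the inequality can be integrated in
    \<open>ennreal\<close> without subtraction. The summand \<open>l^2 * b^2\<close> on the left is
    the constant term of the expansion on the right; it leaves a net error of
    \<open>l^2 * b^2\<close> when the exponential moment is at most 2.\<close>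
  have pointwise: "exp (- l * W z) + (l * W z + l\<^sup>2 * b\<^sup>2) \<le> 1 + l\<^sup>2 * b\<^sup>2 * exp (W z / b)" for z
  proof -
    have "exp (- (l * W z)) \<le> 1 - l * W z + (l * W z)\<^sup>2 / 2"
      using nonneg \<open>0 \<le> l\<close> by (intro exp_minus_le_quadratic) simp
    moreover have "l\<^sup>2 * b\<^sup>2 * (1 + W z / b + (W z / b)\<^sup>2 / 2) \<le> l\<^sup>2 * b\<^sup>2 * exp (W z / b)"
      using nonneg \<open>0 < b\<close> by (intro mult_left_mono exp_lower_Taylor_quadratic) simp_all
    moreover have "l\<^sup>2 * b\<^sup>2 * (1 + W z / b + (W z / b)\<^sup>2 / 2) =
        l\<^sup>2 * b\<^sup>2 + l\<^sup>2 * b * W z + (l * W z)\<^sup>2 / 2"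
      using \<open>0 < b\<close> by (simp add: field_simps power2_eq_square)
    moreover have "0 \<le> l\<^sup>2 * b * W z"
      using nonneg \<open>0 < b\<close> by simp
    ultimately show ?thesis by simp
  qed
  have "I + (ennreal l * 1 + ennreal (l\<^sup>2 * b\<^sup>2)) =
      (\<integral>\<^sup>+ z. ennreal (exp (- l * W z)) + (ennreal l * ennreal (W z) + ennreal (l\<^sup>2 * b\<^sup>2)) \<partial>N)"
    by (simp add: nn_integral_add nn_integral_cmult mean I_def emeasure_space_1)
  also have "\<dots> = (\<integral>\<^sup>+ z. ennreal (exp (- l * W z) + (l * W z + l\<^sup>2 * b\<^sup>2)) \<partial>N)"
    using nonneg \<open>0 \<le> l\<close> by (simp add: ennreal_mult ennreal_plus)
  also have "\<dots> \<le> (\<integral>\<^sup>+ z. ennreal (1 + l\<^sup>2 * b\<^sup>2 * exp (W z / b)) \<partial>N)"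
    by (intro nn_integral_mono ennreal_leI pointwise)
  also have "\<dots> = (\<integral>\<^sup>+ z. 1 + ennreal (l\<^sup>2 * b\<^sup>2) * ennreal (exp (W z / b)) \<partial>N)"
    by (simp add: ennreal_mult ennreal_plus)
  also have "\<dots> = 1 + ennreal (l\<^sup>2 * b\<^sup>2) * (\<integral>\<^sup>+ z. ennreal (exp (W z / b)) \<partial>N)"
    by (simp add: nn_integral_add nn_integral_cmult emeasure_space_1)
  also have "\<dots> \<le> 1 + ennreal (l\<^sup>2 * b\<^sup>2) * 2"
    by (intro add_left_mono mult_left_mono exp_moment) simp
  also have "\<dots> = ennreal (1 + l\<^sup>2 * b\<^sup>2 * 2)"
    by (simp add: ennreal_mult ennreal_plus)
  finally have le: "I + ennreal (l + l\<^sup>2 * b\<^sup>2) \<le> ennreal (1 + l\<^sup>2 * b\<^sup>2 * 2)"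
    using \<open>0 \<le> l\<close> by (simp add: ennreal_plus)
  then have "I \<noteq> top"
    by (auto simp: top_unique)
  then obtain r where r: "I = ennreal r" "0 \<le> r"
    by (metis ennreal_cases infinity_ennreal_def)
  with le have "r + (l + l\<^sup>2 * b\<^sup>2) \<le> 1 + l\<^sup>2 * b\<^sup>2 * 2"
    using \<open>0 \<le> l\<close> by (simp flip: ennreal_plus)
  then have "r \<le> 1 + (- l + l\<^sup>2 * b\<^sup>2)" by (simp add: algebra_simps)
  also have "\<dots> \<le> exp (- l + l\<^sup>2 * b\<^sup>2)" by (rule exp_ge_add_one_self)
  finally have "I \<le> ennreal (exp (- l + l\<^sup>2 * b\<^sup>2))"
    unfolding r(1) by (rule ennreal_leI)
  then show ?thesis
    by (simp only: I_def)
qed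

text \<open>Doubling \<open>s\<close> makes the bound on the infimum strict, so some admissible
  \<open>t\<close> lies below \<open>2 * s\<close>; this avoids showing that the infimum is attained
  and costs the factor 4.\<close>

lemma psi2_norm_exp_moment:
  assumes "psi2_norm M f \<le> ennreal s" "0 < s"
  shows "(\<integral>\<^sup>+ \<omega>. ennreal (exp ((f \<omega>)\<^sup>2 / (4 * s\<^sup>2))) \<partial>M) \<le> 2"
proof -
  have "psi2_norm M f < ennreal (2 * s)"
    using assms by (auto intro!: le_less_trans[OF assms(1)] simp: ennreal_less_iff)
  then obtain t where t: "0 < t" "(\<integral>\<^sup>+ \<omega>. ennreal (exp ((f \<omega>)\<^sup>2 / t\<^sup>2)) \<partial>M) \<le> 2"
      "ennreal t < ennreal (2 * s)"
    unfolding psi2_norm_def INF_less_iff by auto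
  then have "t \<le> 2 * s"
    by (simp add: ennreal_less_iff)
  then have "t\<^sup>2 \<le> 4 * s\<^sup>2"
    using \<open>0 < t\<close> power_mono[of t "2 * s" 2] by simp
  then have "(\<integral>\<^sup>+ \<omega>. ennreal (exp ((f \<omega>)\<^sup>2 / (4 * s\<^sup>2))) \<partial>M) \<le>
      (\<integral>\<^sup>+ \<omega>. ennreal (exp ((f \<omega>)\<^sup>2 / t\<^sup>2)) \<partial>M)"
    using t(1) assms(2) by (intro nn_integral_mono ennreal_leI) (simp add: divide_left_mono)
  with t(2) show ?thesis by simp
qed

text \<open>Markov's inequality for the exponential of the sum, which factorizes by independence. It
  serves lower tails (with a nonpositive \<open>h\<close>) and upper tails alike.\<close>

lemma iid_sample_chernoff:
  assumes iid: "iid_sample n p \<mu> M X" and [measurable]: "h \<in> borel_measurable (Rvec p)"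
    and mgf: "(\<integral>\<^sup>+ z. ennreal (exp (h z)) \<partial>\<mu>) \<le> ennreal (exp b)"
  shows "measure M {\<omega> \<in> space M. a * real n \<le> (\<Sum>i=1..n. h (X i \<omega>))} \<le> exp ((b - a) * real n)"
proof -
  interpret prob_space M
    using iid by (simp add: iid_sample_def)
  have indep: "indep_vars (\<lambda>_. Rvec p) X {1..n}"
    and law: "\<And>i. i \<in> {1..n} \<Longrightarrow> distr M (Rvec p) (X i) = \<mu>"
    using iid by (auto simp: iid_sample_def)
  have X[measurable]: "\<And>i. i \<in> {1..n} \<Longrightarrow> X i \<in> M \<rightarrow>\<^sub>M Rvec p"
    using indep by (auto simp: indep_vars_def)
  have S[measurable]: "(\<lambda>\<omega>. \<Sum>i=1..n. h (X i \<omega>)) \<in> borel_measurable M"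
    by measurable
  have "(\<integral>\<^sup>+ \<omega>. ennreal (exp (\<Sum>i=1..n. h (X i \<omega>))) \<partial>M) =
      (\<integral>\<^sup>+ \<omega>. (\<Prod>i=1..n. ennreal (exp (h (X i \<omega>)))) \<partial>M)"
    by (simp add: exp_sum prod_ennreal)
  also have "\<dots> = (\<Prod>i=1..n. \<integral>\<^sup>+ \<omega>. ennreal (exp (h (X i \<omega>))) \<partial>M)"
    by (intro indep_vars_nn_integral indep_vars_compose2[OF indep]) (simp, measurable)
  also have "\<dots> = (\<Prod>i=1..n. \<integral>\<^sup>+ z. ennreal (exp (h z)) \<partial>\<mu>)"
  proof (intro prod.cong refl)
    fix i assume i: "i \<in> {1..n}"
    show "(\<integral>\<^sup>+ \<omega>. ennreal (exp (h (X i \<omega>))) \<partial>M) = (\<integral>\<^sup>+ z. ennreal (exp (h z)) \<partial>\<mu>)"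
      unfolding law[OF i, symmetric] by (rule nn_integral_distr[symmetric]) (use X[OF i] in measurable)
  qed
  also have "\<dots> \<le> (\<Prod>i=1..n. ennreal (exp b))"
    using mgf by (intro prod_mono_ennreal)
  also have "\<dots> = ennreal (exp (b * real n))"
    by (simp add: ennreal_power exp_of_nat_mult[symmetric] mult.commute)
  finally have E: "(\<integral>\<^sup>+ \<omega>. ennreal (exp (\<Sum>i=1..n. h (X i \<omega>))) \<partial>M) \<le> ennreal (exp (b * real n))" .
  have "{\<omega> \<in> space M. a * real n \<le> (\<Sum>i=1..n. h (X i \<omega>))} =
      {\<omega> \<in> space M. 1 \<le> ennreal (exp (- (a * real n))) * ennreal (exp (\<Sum>i=1..n. h (X i \<omega>)))}"
    by (simp add: ennreal_mult[symmetric] exp_add[symmetric] del: ennreal_1 flip: ennreal_1)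
  then have "emeasure M {\<omega> \<in> space M. a * real n \<le> (\<Sum>i=1..n. h (X i \<omega>))} \<le>
      ennreal (exp (- (a * real n))) * (\<integral>\<^sup>+ \<omega>. ennreal (exp (\<Sum>i=1..n. h (X i \<omega>))) \<partial>M)"
    using nn_integral_Markov_inequality[of "\<lambda>\<omega>. ennreal (exp (\<Sum>i=1..n. h (X i \<omega>)))" "space M" M
        "ennreal (exp (- (a * real n)))"]
    by (simp cong: nn_integral_cong)
  also have "\<dots> \<le> ennreal (exp (- (a * real n))) * ennreal (exp (b * real n))"
    by (intro mult_left_mono E) simp
  also have "\<dots> = ennreal (exp ((b - a) * real n))"
    by (simp add: ennreal_mult[symmetric] exp_add[symmetric] algebra_simps)
  finally show ?thesis
    by (simp add: emeasure_eq_measure)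
qed

section \<open>Sums of signed basis vectors and Maurey's averaging\<close>

text \<open>With \<open>w\<close> read as a probability distribution, this says that a second moment
  is the squared mean plus the variance. The variance does not depend on the shift \<open>a\<close>,
  which is what later makes \<open>V\<close> the same at every step.\<close>

lemma sum_weighted_square_shift:
  fixes w b :: "'a \<Rightarrow> real"
  assumes "(\<Sum>j\<in>J. w j) = 1"
  shows "(\<Sum>j\<in>J. w j * (a + b j)\<^sup>2) =
    (a + (\<Sum>j\<in>J. w j * b j))\<^sup>2 + (\<Sum>j\<in>J. w j * (b j)\<^sup>2) - (\<Sum>j\<in>J. w j * b j)\<^sup>2"
proof -
  have "(\<Sum>j\<in>J. w j * (a + b j)\<^sup>2) =
      (\<Sum>j\<in>J. w j) * a\<^sup>2 + 2 * a * (\<Sum>j\<in>J. w j * b j) + (\<Sum>j\<in>J. w j * (b j)\<^sup>2)"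
    by (simp add: sum_distrib_left sum_distrib_right sum.distrib[symmetric] power2_eq_square algebra_simps)
  then show ?thesis
    using assms by (simp add: power2_eq_square algebra_simps)
qed

text \<open>Extended by 0 instead of \<open>undefined\<close>, so that vectors can be added
  pointwise; the inner product and the norms read only the coordinates in
  \<open>{1..p}\<close>.\<close>

definition signed_unit :: "real \<Rightarrow> nat \<Rightarrow> nat \<Rightarrow> real" where
  "signed_unit s j = (\<lambda>k. if k = j then s else 0)"

fun signed_unit_sums :: "nat \<Rightarrow> nat \<Rightarrow> (nat \<Rightarrow> real) set" where
  "signed_unit_sums p 0 = {\<lambda>_. 0}"
| "signed_unit_sums p (Suc m) =
     (\<lambda>(s, j, u). (\<lambda>k. signed_unit s j k + u k)) ` ({-1, 1} \<times> {1..p} \<times> signed_unit_sums p m)"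

lemma finite_signed_unit_sums: "finite (signed_unit_sums p m)"
  by (induction m) auto

lemma card_signed_unit_sums: "card (signed_unit_sums p m) \<le> (2 * p) ^ m"
proof (induction m)
  case (Suc m)
  have "card (signed_unit_sums p (Suc m)) \<le> card ({-1, 1 :: real} \<times> {1..p} \<times> signed_unit_sums p m)"
    by (auto intro!: card_image_le finite_signed_unit_sums)
  also have "\<dots> = 2 * p * card (signed_unit_sums p m)"
    by (simp add: card_cartesian_product)
  also have "\<dots> \<le> 2 * p * (2 * p) ^ m"
    using Suc by simp
  finally show ?case by simp
qed simp

text \<open>
  Adding the \<open>m\<close> random vectors one at a time replaces the expectation over \<open>m\<close>-tuples by an
  induction; \<open>V\<close> is the variance contributed by each of them.
\<close>

lemma maurey_average_nonneg:
  fixes Q :: "(nat \<Rightarrow> real) \<Rightarrow> real"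
  assumes "\<And>j. j \<in> {1..p} \<Longrightarrow> 0 \<le> w j" and "(\<Sum>j=1..p. w j) = 1"
    and "\<And>j. j \<in> {1..p} \<Longrightarrow> s j \<in> {-1, 1}"
    and avg: "\<And>u. (\<Sum>j=1..p. w j * Q (\<lambda>k. u k + signed_unit (s j) j k)) = Q (\<lambda>k. u k + x k) + V"
    and "\<And>z. z \<in> signed_unit_sums p m \<Longrightarrow> 0 \<le> Q (\<lambda>k. u k + z k)"
  shows "0 \<le> Q (\<lambda>k. u k + real m * x k) + real m * V"
  using assms(5)
proof (induction m arbitrary: u)
  case 0
  then show ?case by simp
next
  case (Suc m)
  let ?u = "\<lambda>k. u k + real m * x k"
  \<comment> \<open>One signed basis vector is moved into the base point and the induction
    hypothesis is applied there. Averaging over \<open>j\<close> with \<open>avg\<close> at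
    \<open>?u\<close> then replaces that vector by \<open>x\<close>, at the cost of one more
    \<open>V\<close>.\<close>
  have "0 \<le> Q (\<lambda>k. ?u k + signed_unit (s j) j k) + real m * V" if j: "j \<in> {1..p}" for j
  proof -
    have "0 \<le> Q (\<lambda>k. (u k + signed_unit (s j) j k) + real m * x k) + real m * V"
    proof (rule Suc.IH)
      fix z assume "z \<in> signed_unit_sums p m"
      then have "(\<lambda>k. signed_unit (s j) j k + z k) \<in> signed_unit_sums p (Suc m)"
        using j assms(3)[OF j] by (auto intro!: image_eqI[of _ _ "(s j, j, z)"])
      from Suc.prems[OF this] show "0 \<le> Q (\<lambda>k. u k + signed_unit (s j) j k + z k)"
        by (simp add: add.assoc)
    qed
    then show ?thesis by (simp add: add_ac)
  qed
  then have "0 \<le> (\<Sum>j=1..p. w j * (Q (\<lambda>k. ?u k + signed_unit (s j) j k) + real m * V))"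
    using assms(1) by (intro sum_nonneg mult_nonneg_nonneg) auto
  also have "\<dots> = Q (\<lambda>k. ?u k + x k) + V + real m * V"
    by (simp only: distrib_left sum.distrib avg sum_distrib_right[symmetric] assms(2) mult_1)
  finally show ?case
    by (simp add: algebra_simps)
qed

section \<open>The quadratic form and its deterministic lower bound\<close>

text \<open>The form \<open>Q\<close> of the overview for a fixed realisation \<open>Y\<close> of
  the sample.\<close>

definition quad_gap :: "nat \<Rightarrow> nat \<Rightarrow> (nat \<Rightarrow> nat \<Rightarrow> real) \<Rightarrow> (nat \<Rightarrow> real) \<Rightarrow> real" where
  "quad_gap n p Y z = (\<Sum>i=1..n. (dotp p (Y i) z)\<^sup>2) / real n - (\<Sum>j=1..p. (z j)\<^sup>2) / 2"

lemma dotp_add: "dotp p y (\<lambda>k. u k + v k) = dotp p y u + dotp p y v"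
  by (simp add: dotp_def algebra_simps sum.distrib)

lemma dotp_scale: "dotp p y (\<lambda>k. c * v k) = c * dotp p y v"
  by (simp add: dotp_def algebra_simps sum_distrib_left)

lemma dotp_signed_unit: "j \<in> {1..p} \<Longrightarrow> dotp p y (signed_unit s j) = s * y j"
  by (simp add: dotp_def signed_unit_def if_distrib cong: if_cong)

lemma quad_gap_scale: "quad_gap n p Y (\<lambda>k. c * z k) = c\<^sup>2 * quad_gap n p Y z"
  by (simp add: quad_gap_def dotp_scale power_mult_distrib sum_distrib_left[symmetric] algebra_simps)

text \<open>The random vector that is the basis vector number \<open>j\<close> with sign
  \<open>s j\<close>, with probability \<open>w j\<close>, has mean \<open>x\<close>; the variance
  identity is applied to a linear functional of it.\<close>

lemma sum_weighted_dotp_shift: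
  assumes "(\<Sum>j=1..p. w j) = 1" and "\<And>j. j \<in> {1..p} \<Longrightarrow> w j * s j = x j"
  shows "(\<Sum>j=1..p. w j * (dotp p y (\<lambda>k. u k + signed_unit (s j) j k))\<^sup>2) =
    (dotp p y (\<lambda>k. u k + x k))\<^sup>2 + (\<Sum>j=1..p. w j * (dotp p y (signed_unit (s j) j))\<^sup>2) - (dotp p y x)\<^sup>2"
proof -
  have "(\<Sum>j=1..p. w j * dotp p y (signed_unit (s j) j)) = dotp p y x"
    unfolding dotp_def[of p y x]
    using assms(2) by (intro sum.cong) (auto simp: dotp_signed_unit simp flip: assms(2))
  then show ?thesis
    using sum_weighted_square_shift[OF assms(1), of "dotp p y u" "\<lambda>j. dotp p y (signed_unit (s j) j)"]
    by (simp add: dotp_add)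
qed

text \<open>\<open>quad_gap\<close> is a linear combination of squares of linear functionals, so the
  identity for one functional carries over. The bracket is the \<open>V\<close> of Maurey's
  argument.\<close>

lemma sum_weighted_quad_gap_shift:
  assumes "(\<Sum>j=1..p. w j) = 1" and "\<And>j. j \<in> {1..p} \<Longrightarrow> w j * s j = x j"
  shows "(\<Sum>j=1..p. w j * quad_gap n p Y (\<lambda>k. u k + signed_unit (s j) j k)) =
    quad_gap n p Y (\<lambda>k. u k + x k) +
    ((\<Sum>j=1..p. w j * quad_gap n p Y (signed_unit (s j) j)) - quad_gap n p Y x)"
proof -
  \<comment> \<open>Coordinates are written as inner products with basis vectors, so that one shift
    identity covers both sums in \<open>quad_gap\<close>.\<close>
  have coord: "(\<Sum>k=1..p. (z k)\<^sup>2) = (\<Sum>k=1..p. (dotp p (signed_unit 1 k) z)\<^sup>2)" for z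
    by (intro sum.cong refl)
      (simp add: dotp_def signed_unit_def if_distrib[of "\<lambda>a. a * _"] cong: if_cong)
  have gap: "quad_gap n p Y z = (\<Sum>i=1..n. (dotp p (Y i) z)\<^sup>2) / real n -
      (\<Sum>k=1..p. (dotp p (signed_unit 1 k) z)\<^sup>2) / 2" for z
    by (simp only: quad_gap_def coord[of z])
  have avg: "(\<Sum>j=1..p. w j * quad_gap n p Y (f j)) =
      (\<Sum>i=1..n. \<Sum>j=1..p. w j * (dotp p (Y i) (f j))\<^sup>2) / real n -
      (\<Sum>k=1..p. \<Sum>j=1..p. w j * (dotp p (signed_unit 1 k) (f j))\<^sup>2) / 2" for f
  proof -
    have "(\<Sum>j=1..p. w j * quad_gap n p Y (f j)) =
        (\<Sum>j=1..p. \<Sum>i=1..n. w j * (dotp p (Y i) (f j))\<^sup>2) / real n -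
        (\<Sum>j=1..p. \<Sum>k=1..p. w j * (dotp p (signed_unit 1 k) (f j))\<^sup>2) / 2"
      by (simp add: gap right_diff_distrib sum_subtractf sum_distrib_left
          sum_divide_distrib)
    then show ?thesis
      by (simp only: sum.swap[of _ "{1..p}" "{1..n}"] sum.swap[of "\<lambda>j k. w j * (dotp p (signed_unit 1 k) (f j))\<^sup>2"])
  qed
  have shift: "(\<Sum>j=1..p. w j * (dotp p y (\<lambda>k. u k + signed_unit (s j) j k))\<^sup>2) =
      (dotp p y (\<lambda>k. u k + x k))\<^sup>2 +
      (\<Sum>j=1..p. w j * (dotp p y (signed_unit (s j) j))\<^sup>2) - (dotp p y x)\<^sup>2" for y
    by (rule sum_weighted_dotp_shift[where s = s and x = x and w = w, OF assms])
  show ?thesis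
    unfolding avg shift
    by (simp add: gap sum.distrib sum_subtractf diff_divide_distrib add_divide_distrib)
qed

lemma quad_gap_lower_bound:
  assumes "n \<ge> 1" "m \<ge> 2" "0 \<le> K"
    and sparse: "\<And>z. z \<in> signed_unit_sums p m \<Longrightarrow> 0 \<le> quad_gap n p Y z"
    and diag: "\<And>j. j \<in> {1..p} \<Longrightarrow> (\<Sum>i=1..n. (Y i j)\<^sup>2) / real n \<le> K"
  shows "- (2 * K / real m) * (l1_norm p x)\<^sup>2 \<le> quad_gap n p Y x"
proof (cases "l1_norm p x = 0")
  case True
  then have "\<And>j. j \<in> {1..p} \<Longrightarrow> x j = 0"
    by (simp add: l1_norm_def sum_nonneg_eq_0_iff)
  then show ?thesis
    using True by (simp add: quad_gap_def dotp_def)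
next
  case False
  define r where "r = l1_norm p x"
  have "0 < r"
    using False by (simp add: r_def l1_norm_def less_le sum_nonneg)
  define w where "w j = \<bar>x j\<bar> / r" for j
  \<comment> \<open>The sign at a zero coordinate is set to 1 to stay in \<open>{-1, 1}\<close>; its
    weight is 0.\<close>
  define s :: "nat \<Rightarrow> real" where "s j = (if x j < 0 then -1 else 1)" for j
  define x' where "x' k = x k / r" for k
  have w_sum: "(\<Sum>j=1..p. w j) = 1"
    using \<open>0 < r\<close> by (simp add: w_def sum_divide_distrib[symmetric]) (simp add: r_def l1_norm_def)
  have w_nonneg: "0 \<le> w j" for j
    using \<open>0 < r\<close> by (simp add: w_def)
  have ws: "w j * s j = x' j" for j
    by (simp add: w_def s_def x'_def)
  let ?A = "\<Sum>j=1..p. w j * quad_gap n p Y (signed_unit (s j) j)"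
  have "0 \<le> quad_gap n p Y (\<lambda>k. 0 + real m * x' k) + real m * (?A - quad_gap n p Y x')"
    by (rule maurey_average_nonneg[where w = w and s = s])
      (use w_nonneg w_sum sparse sum_weighted_quad_gap_shift[OF w_sum ws] in \<open>auto simp: s_def\<close>)
  then have "0 \<le> real m * ((real m - 1) * quad_gap n p Y x' + ?A)"
    by (simp add: quad_gap_scale power2_eq_square algebra_simps)
  then have *: "0 \<le> (real m - 1) * quad_gap n p Y x' + ?A"
    using \<open>m \<ge> 2\<close> by (simp add: zero_le_mult_iff)
  have "?A \<le> (\<Sum>j=1..p. w j * K)"
  proof (intro sum_mono mult_left_mono w_nonneg)
    fix j assume j: "j \<in> {1..p}"
    have "quad_gap n p Y (signed_unit (s j) j) \<le> (\<Sum>i=1..n. (s j * Y i j)\<^sup>2) / real n"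
      using j by (simp add: quad_gap_def dotp_signed_unit sum_nonneg)
    also have "\<dots> = (\<Sum>i=1..n. (Y i j)\<^sup>2) / real n"
      by (simp add: s_def)
    also have "\<dots> \<le> K"
      using j by (rule diag)
    finally show "quad_gap n p Y (signed_unit (s j) j) \<le> K" .
  qed
  also have "\<dots> = K"
    using w_sum by (simp add: sum_distrib_right[symmetric])
  finally have A: "?A \<le> K" .
  have "- (2 * K / real m) \<le> quad_gap n p Y x'"
  proof (cases "0 \<le> quad_gap n p Y x'")
    case True
    have "0 \<le> 2 * K / real m" using \<open>0 \<le> K\<close> by simp
    with True show ?thesis by linarith
  next
    case False
    \<comment> \<open>From \<open>m \<ge> 2\<close> follows \<open>m - 1 \<ge> m / 2\<close>; this
      is the source of the factor 2 in the bound.\<close>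
    have "(real m - 1) * quad_gap n p Y x' \<le> (real m / 2) * quad_gap n p Y x'"
      using False \<open>m \<ge> 2\<close> by (intro mult_right_mono_neg) auto
    with * A have "0 \<le> (real m / 2) * quad_gap n p Y x' + K" by linarith
    then show ?thesis
      using \<open>m \<ge> 2\<close> by (simp add: field_simps)
  qed
  then have "r\<^sup>2 * - (2 * K / real m) \<le> r\<^sup>2 * quad_gap n p Y x'"
    by (intro mult_left_mono) auto
  also have "\<dots> = quad_gap n p Y x"
    using \<open>0 < r\<close> by (simp add: quad_gap_scale[symmetric] x'_def)
  finally show ?thesis
    by (simp add: r_def mult.commute)
qed

lemma l1_norm_nonneg: "0 \<le> l1_norm p x"
  by (simp add: l1_norm_def sum_nonneg)

lemma l2_norm_Gamma_map:
  "l2_norm n (Gamma_map n p Y x) = sqrt (\<Sum>i=1..n. (dotp p (Y i) x)\<^sup>2)"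
proof -
  have "Gamma_map n p Y x k = dotp p (Y k) x" if "k \<in> {1..n}" for k
  proof -
    have "Gamma_map n p Y x k = (\<Sum>i=1..n. dotp p (Y i) x * unit_vec n i k)"
      using that by (simp add: Gamma_map_def)
    also have "\<dots> = (\<Sum>i=1..n. if k = i then dotp p (Y i) x else 0)"
      using that by (intro sum.cong) (auto simp: unit_vec_def)
    finally show ?thesis using that by simp
  qed
  then show ?thesis
    by (simp add: l2_norm_def L2_set_def)
qed

text \<open>Square roots are taken in \<open>a^2 + d^2 \<le> (a + d)^2\<close>. The factor obtained
  would be 1 over the square root of 2; it is weakened to the 1/4 of the theorem.\<close>

lemma l2_norm_bound_of_quad_gap:
  assumes gap: "- D\<^sup>2 * (l1_norm p x)\<^sup>2 \<le> quad_gap n p Y x" and "0 \<le> D"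
  shows "l2_norm p x / 4 - D * l1_norm p x \<le> l2_norm n (Gamma_map n p Y x) / sqrt (real n)"
proof -
  define a where "a = l2_norm n (Gamma_map n p Y x) / sqrt (real n)"
  define d where "d = D * l1_norm p x"
  have "0 \<le> a" "0 \<le> d"
    using assms(2) l1_norm_nonneg[of p x]
    by (auto simp: a_def d_def l2_norm_def L2_set_nonneg)
  have a2: "a\<^sup>2 = (\<Sum>i=1..n. (dotp p (Y i) x)\<^sup>2) / real n"
    by (simp add: a_def l2_norm_Gamma_map power_divide sum_nonneg)
  have l2: "(l2_norm p x)\<^sup>2 = (\<Sum>j=1..p. (x j)\<^sup>2)"
    by (simp add: l2_norm_def L2_set_def sum_nonneg)
  have "(l2_norm p x)\<^sup>2 / 2 \<le> a\<^sup>2 + d\<^sup>2"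
    using gap unfolding quad_gap_def a2[symmetric] l2[symmetric] d_def power_mult_distrib
    by linarith
  also have "\<dots> \<le> (a + d)\<^sup>2"
    using \<open>0 \<le> a\<close> \<open>0 \<le> d\<close> by (simp add: power2_sum)
  finally have "(l2_norm p x)\<^sup>2 / 16 \<le> (a + d)\<^sup>2"
    using zero_le_power2[of "a + d"] by linarith
  then have "(l2_norm p x / 4)\<^sup>2 \<le> (a + d)\<^sup>2"
    by (simp add: power_divide)
  then have "l2_norm p x / 4 \<le> a + d"
    by (rule power2_le_imp_le) (use \<open>0 \<le> a\<close> \<open>0 \<le> d\<close> in linarith)
  then show ?thesis
    unfolding a_def d_def by linarith
qed

section \<open>Probabilities of the bad events\<close>

lemma measurable_dotp[measurable]: "(\<lambda>y. dotp p y z) \<in> borel_measurable (Rvec p)"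
  unfolding dotp_def by measurable

text \<open>The assumptions on the law quantify over vectors that are \<open>undefined\<close>
  outside \<open>{1..p}\<close>; restriction transfers them to arbitrary functions
  \<open>z\<close>.\<close>

lemma dotp_restrict: "dotp p y (restrict z {1..p}) = dotp p y z"
  by (simp add: dotp_def)

lemma psi2_exp_moment:
  assumes "psi2_with_const p \<alpha> \<mu>" "0 < \<alpha>" "0 < (\<Sum>j=1..p. (z j)\<^sup>2)"
  shows "(\<integral>\<^sup>+ y. ennreal (exp ((dotp p y z)\<^sup>2 / (\<Sum>j=1..p. (z j)\<^sup>2) / (4 * \<alpha>\<^sup>2))) \<partial>\<mu>) \<le> 2"
proof -
  let ?z = "restrict z {1..p}"
  have l2: "l2_norm p ?z = sqrt (\<Sum>j=1..p. (z j)\<^sup>2)"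
    by (simp add: l2_norm_def L2_set_def)
  have "?z \<in> space (Rvec p)"
    by (simp add: space_PiM)
  then have "psi2_norm \<mu> (\<lambda>y. dotp p y ?z) \<le> ennreal (\<alpha> * l2_norm p ?z)"
    using assms(1) unfolding psi2_with_const_def by blast
  from psi2_norm_exp_moment[OF this] show ?thesis
    using assms(2,3) by (simp add: l2 dotp_restrict power_mult_distrib mult_ac del: One_nat_def)
qed

lemma isotropic_second_moment:
  assumes "isotropic p \<mu>"
  shows "(\<integral>\<^sup>+ y. ennreal ((dotp p y z)\<^sup>2) \<partial>\<mu>) = ennreal (\<Sum>j=1..p. (z j)\<^sup>2)"
proof -
  let ?z = "restrict z {1..p}"
  have l2: "(l2_norm p ?z)\<^sup>2 = (\<Sum>j=1..p. (z j)\<^sup>2)"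
    by (simp add: l2_norm_def L2_set_def sum_nonneg)
  have "?z \<in> space (Rvec p)"
    by (simp add: space_PiM)
  then have "(\<integral>\<^sup>+ y. ennreal (\<bar>dotp p y ?z\<bar>\<^sup>2) \<partial>\<mu>) = ennreal ((l2_norm p ?z)\<^sup>2)"
    using assms unfolding isotropic_def by blast
  then show ?thesis
    by (simp add: l2 dotp_restrict del: One_nat_def)
qed

lemma iid_sample_measurable:
  "iid_sample n p \<mu> M X \<Longrightarrow> i \<in> {1..n} \<Longrightarrow> X i \<in> M \<rightarrow>\<^sub>M Rvec p"
  by (auto simp: iid_sample_def prob_space.indep_vars_def)

text \<open>The normalised square \<open>W\<close> has mean 1, and a negative gap means that its
  empirical mean is below 1/2. This is a lower tail, bounded through the exponential moment of
  \<open>- l * W\<close>.\<close>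

lemma prob_quad_gap_neg:
  assumes iid: "iid_sample n p \<mu> M X" and "prob_space \<mu>" and sets: "sets \<mu> = sets (Rvec p)"
    and "isotropic p \<mu>" "psi2_with_const p \<alpha> \<mu>" "1 \<le> \<alpha>" "n \<ge> 1"
  shows "measure M {\<omega> \<in> space M. quad_gap n p (\<lambda>i. X i \<omega>) z < 0} \<le> exp (- real n / (256 * \<alpha>^4))"
proof -
  interpret prob_space M
    using iid by (simp add: iid_sample_def)
  note X[measurable] = iid_sample_measurable[OF iid]
  note [measurable_cong] = sets
  define S where "S = (\<Sum>j=1..p. (z j)\<^sup>2)"
  show ?thesis
  \<comment> \<open>Signed basis vectors may cancel, so \<open>z\<close> can vanish; then the event
    is empty and normalising by \<open>S\<close> is impossible.\<close>
  proof (cases "S = 0")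
    case True
    then have "\<And>j. j \<in> {1..p} \<Longrightarrow> z j = 0"
      by (simp add: S_def sum_nonneg_eq_0_iff)
    then have "quad_gap n p Y z = 0" for Y
      by (simp add: quad_gap_def dotp_def)
    then show ?thesis by simp
  next
    case False
    then have "0 < S"
      by (simp add: S_def less_le sum_nonneg)
    \<comment> \<open>With \<open>b = 4 * \<alpha>^2\<close> the error \<open>l^2 * b^2\<close>
      equals \<open>l / 4\<close>, so the exponent is
      \<open>- l + l / 4 + l / 2 = - l / 4\<close>.\<close>
    define l where "l = 1 / (64 * \<alpha>^4)"
    define W where "W y = (dotp p y z)\<^sup>2 / S" for y
    have [measurable]: "W \<in> borel_measurable (Rvec p)"
      unfolding W_def by measurable
    have "0 < l" using \<open>1 \<le> \<alpha>\<close> by (simp add: l_def)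
    have "(\<integral>\<^sup>+ y. ennreal (W y) \<partial>\<mu>) = (\<integral>\<^sup>+ y. ennreal (1 / S) * ennreal ((dotp p y z)\<^sup>2) \<partial>\<mu>)"
      using \<open>0 < S\<close> by (simp add: W_def ennreal_mult[symmetric])
    also have "\<dots> = ennreal (1 / S) * ennreal S"
      using isotropic_second_moment[OF assms(4), of z] by (simp add: nn_integral_cmult S_def)
    also have "\<dots> = 1"
      using \<open>0 < S\<close> by (simp add: ennreal_mult[symmetric])
    finally have mean: "(\<integral>\<^sup>+ y. ennreal (W y) \<partial>\<mu>) = 1" .
    have "(\<integral>\<^sup>+ y. ennreal (exp (W y / (4 * \<alpha>\<^sup>2))) \<partial>\<mu>) \<le> 2"
      using psi2_exp_moment[OF assms(5), of z] \<open>0 < S\<close> \<open>1 \<le> \<alpha>\<close> by (simp add: W_def S_def)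
    then have "(\<integral>\<^sup>+ y. ennreal (exp (- l * W y)) \<partial>\<mu>) \<le> ennreal (exp (- l + l\<^sup>2 * (4 * \<alpha>\<^sup>2)\<^sup>2))"
      using \<open>0 < S\<close> \<open>0 < l\<close> \<open>1 \<le> \<alpha>\<close> mean
      by (intro nn_integral_exp_minus_le[OF assms(2)]) (auto simp: W_def)
    moreover have "(\<lambda>y. - l * W y) \<in> borel_measurable (Rvec p)"
      by measurable
    ultimately have "measure M {\<omega> \<in> space M. - l / 2 * real n \<le> (\<Sum>i=1..n. - l * W (X i \<omega>))}
        \<le> exp ((- l + l\<^sup>2 * (4 * \<alpha>\<^sup>2)\<^sup>2 - - l / 2) * real n)"
      by (intro iid_sample_chernoff[OF iid])
    moreover have "(- l + l\<^sup>2 * (4 * \<alpha>\<^sup>2)\<^sup>2 - - l / 2) = - 1 / (256 * \<alpha>^4)"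
      using \<open>1 \<le> \<alpha>\<close> by (simp add: l_def field_simps power2_eq_square power4_eq_xxxx)
    moreover have "measure M {\<omega> \<in> space M. quad_gap n p (\<lambda>i. X i \<omega>) z < 0} \<le>
        measure M {\<omega> \<in> space M. - l / 2 * real n \<le> (\<Sum>i=1..n. - l * W (X i \<omega>))}"
    proof (rule finite_measure_mono)
      show "{\<omega> \<in> space M. quad_gap n p (\<lambda>i. X i \<omega>) z < 0} \<subseteq>
          {\<omega> \<in> space M. - l / 2 * real n \<le> (\<Sum>i=1..n. - l * W (X i \<omega>))}"
      proof safe
        fix \<omega> assume "quad_gap n p (\<lambda>i. X i \<omega>) z < 0"
        then have "(\<Sum>i=1..n. (dotp p (X i \<omega>) z)\<^sup>2) \<le> S / 2 * real n"
          using \<open>n \<ge> 1\<close> by (simp add: quad_gap_def S_def field_simps)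
        then have "(\<Sum>i=1..n. W (X i \<omega>)) \<le> real n / 2"
          using \<open>0 < S\<close> by (simp add: W_def sum_divide_distrib[symmetric] field_simps)
        then have "l * (\<Sum>i=1..n. W (X i \<omega>)) \<le> l * (real n / 2)"
          using \<open>0 < l\<close> by (intro mult_left_mono) auto
        then show "- l / 2 * real n \<le> (\<Sum>i=1..n. - l * W (X i \<omega>))"
          by (simp add: sum_negf sum_distrib_left)
      qed
    qed measurable
    ultimately show ?thesis by simp
  qed
qed

text \<open>The squared coordinate over \<open>4 * \<alpha>^2\<close> has exponential moment at most
  \<open>exp (ln 2)\<close>. The threshold \<open>8 * \<alpha>^2\<close> becomes 2 after this
  scaling, and 2 exceeds \<open>ln 2\<close> by more than 1.\<close>

lemma prob_coordinate_large:
  assumes iid: "iid_sample n p \<mu> M X"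
    and "psi2_with_const p \<alpha> \<mu>" "1 \<le> \<alpha>" "n \<ge> 1" and j: "j \<in> {1..p}"
  shows "measure M {\<omega> \<in> space M. 8 * \<alpha>\<^sup>2 < (\<Sum>i=1..n. (X i \<omega> j)\<^sup>2) / real n} \<le> exp (- real n)"
proof -
  interpret prob_space M
    using iid by (simp add: iid_sample_def)
  note X[measurable] = iid_sample_measurable[OF iid]
  define h where "h y = (y j)\<^sup>2 / (4 * \<alpha>\<^sup>2)" for y :: "nat \<Rightarrow> real"
  have [measurable]: "h \<in> borel_measurable (Rvec p)"
    unfolding h_def using j by measurable
  have "(\<Sum>k=1..p. (signed_unit 1 j k)\<^sup>2) = 1"
    using j by (simp add: signed_unit_def if_distrib[of "\<lambda>a. a\<^sup>2"] cong: if_cong)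
  then have "(\<integral>\<^sup>+ y. ennreal (exp (h y)) \<partial>\<mu>) \<le> 2"
    using psi2_exp_moment[OF assms(2), of "signed_unit 1 j"] \<open>1 \<le> \<alpha>\<close> j
    by (simp add: h_def dotp_signed_unit)
  also have "\<dots> = ennreal (exp (ln 2))"
    by simp
  finally have "measure M {\<omega> \<in> space M. 2 * real n \<le> (\<Sum>i=1..n. h (X i \<omega>))} \<le> exp ((ln 2 - 2) * real n)"
    by (intro iid_sample_chernoff[OF iid]) measurable
  also have "\<dots> \<le> exp (- 1 * real n)"
    using ln_2_less_1 by (intro exp_le_cancel_iff[THEN iffD2] mult_right_mono) auto
  finally have "measure M {\<omega> \<in> space M. 2 * real n \<le> (\<Sum>i=1..n. h (X i \<omega>))} \<le> exp (- real n)"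
    by simp
  moreover have "measure M {\<omega> \<in> space M. 8 * \<alpha>\<^sup>2 < (\<Sum>i=1..n. (X i \<omega> j)\<^sup>2) / real n} \<le>
      measure M {\<omega> \<in> space M. 2 * real n \<le> (\<Sum>i=1..n. h (X i \<omega>))}"
    using \<open>1 \<le> \<alpha>\<close> \<open>n \<ge> 1\<close>
    by (intro finite_measure_mono)
      ((force simp: h_def sum_divide_distrib[symmetric] field_simps)[1], measurable)
  ultimately show ?thesis by simp
qed

text \<open>Union bound over at most \<open>(2 * p)^m\<close> sparse vectors and \<open>p\<close>
  coordinates; off these bad events the deterministic bound applies with
  \<open>K = 8 * \<alpha>^2\<close>, whence \<open>16 * \<alpha>^2\<close>.\<close>

lemma prob_ge_of_quad_gap_lower_bound:
  assumes iid: "iid_sample n p \<mu> M X" and "prob_space \<mu>" "sets \<mu> = sets (Rvec p)"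
    and "isotropic p \<mu>" "psi2_with_const p \<alpha> \<mu>" "1 \<le> \<alpha>" "n \<ge> 1" "m \<ge> 2"
    and E[measurable]: "{\<omega> \<in> space M. P \<omega>} \<in> sets M"
    and imp: "\<And>\<omega>. \<omega> \<in> space M \<Longrightarrow>
      (\<And>x. - (16 * \<alpha>\<^sup>2 / real m) * (l1_norm p x)\<^sup>2 \<le> quad_gap n p (\<lambda>i. X i \<omega>) x) \<Longrightarrow> P \<omega>"
  shows "1 - ((2 * real p) ^ m * exp (- real n / (256 * \<alpha>^4)) + real p * exp (- real n))
    \<le> measure M {\<omega> \<in> space M. P \<omega>}"
proof -
  interpret prob_space M
    using iid by (simp add: iid_sample_def)
  note X[measurable] = iid_sample_measurable[OF iid]
  let ?S = "signed_unit_sums p m"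
  let ?A = "\<lambda>z. {\<omega> \<in> space M. quad_gap n p (\<lambda>i. X i \<omega>) z < 0}"
  let ?B = "\<lambda>j. {\<omega> \<in> space M. 8 * \<alpha>\<^sup>2 < (\<Sum>i=1..n. (X i \<omega> j)\<^sup>2) / real n}"
  have A: "?A z \<in> sets M" for z
    unfolding quad_gap_def by measurable
  have B: "?B j \<in> sets M" if j: "j \<in> {1..p}" for j
  proof -
    have [measurable]: "(\<lambda>\<omega>. X i \<omega> j) \<in> borel_measurable M" if "i \<in> {1..n}" for i
      by (rule measurable_compose[OF X[OF that] measurable_component_singleton[OF j]])
    show ?thesis by measurable
  qed
  have "{\<omega> \<in> space M. \<not> P \<omega>} \<subseteq> (\<Union>z\<in>?S. ?A z) \<union> (\<Union>j\<in>{1..p}. ?B j)"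
  proof (rule subsetI, rule ccontr)
    fix \<omega> assume \<omega>: "\<omega> \<in> {\<omega> \<in> space M. \<not> P \<omega>}"
      and not: "\<omega> \<notin> (\<Union>z\<in>?S. ?A z) \<union> (\<Union>j\<in>{1..p}. ?B j)"
    have sparse: "0 \<le> quad_gap n p (\<lambda>i. X i \<omega>) z" if "z \<in> ?S" for z
    proof (rule ccontr)
      assume "\<not> ?thesis"
      then have "\<omega> \<in> ?A z" using \<omega> by simp
      with not that show False by blast
    qed
    have diag: "(\<Sum>i=1..n. (X i \<omega> j)\<^sup>2) / real n \<le> 8 * \<alpha>\<^sup>2" if "j \<in> {1..p}" for j
    proof (rule ccontr)
      assume "\<not> ?thesis"
      then have "\<omega> \<in> ?B j" using \<omega> by simp
      with not that show False by blast
    qed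
    have "- (2 * (8 * \<alpha>\<^sup>2) / real m) * (l1_norm p x)\<^sup>2 \<le> quad_gap n p (\<lambda>i. X i \<omega>) x" for x
      by (rule quad_gap_lower_bound[OF \<open>n \<ge> 1\<close> \<open>m \<ge> 2\<close> _ sparse diag]) simp_all
    then have "P \<omega>"
      using \<omega> by (intro imp) auto
    then show False using \<omega> by simp
  qed
  then have "measure M {\<omega> \<in> space M. \<not> P \<omega>} \<le> measure M ((\<Union>z\<in>?S. ?A z) \<union> (\<Union>j\<in>{1..p}. ?B j))"
    using A B finite_signed_unit_sums by (intro finite_measure_mono sets.Un sets.finite_UN) auto
  also have "\<dots> \<le> measure M (\<Union>z\<in>?S. ?A z) + measure M (\<Union>j\<in>{1..p}. ?B j)"
    using A B finite_signed_unit_sums by (intro measure_Un_le sets.finite_UN) auto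
  also have "\<dots> \<le> (\<Sum>z\<in>?S. measure M (?A z)) + (\<Sum>j\<in>{1..p}. measure M (?B j))"
    using A B finite_signed_unit_sums by (intro add_mono measure_UNION_le) auto
  also have "\<dots> \<le> (\<Sum>z\<in>?S. exp (- real n / (256 * \<alpha>^4))) + (\<Sum>j\<in>{1..p}. exp (- real n))"
    using assms by (intro add_mono sum_mono prob_quad_gap_neg prob_coordinate_large) auto
  also have "\<dots> = real (card ?S) * exp (- real n / (256 * \<alpha>^4)) + real p * exp (- real n)"
    by simp
  also have "\<dots> \<le> (2 * real p) ^ m * exp (- real n / (256 * \<alpha>^4)) + real p * exp (- real n)"
    using of_nat_mono[OF card_signed_unit_sums[of p m], where 'a = real]
    by (intro add_right_mono mult_right_mono) simp_all
  finally show ?thesis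
    using prob_neg[OF E] by simp
qed

section \<open>Measurability of the event\<close>

lemma l2_l1_bound_limit:
  fixes f :: "nat \<Rightarrow> nat \<Rightarrow> real"
  assumes lim: "\<And>j. j \<in> {1..p} \<Longrightarrow> (\<lambda>k. f k j) \<longlonglongrightarrow> x j"
    and ineq: "\<And>k. l2_norm p (f k) / 4 - D * l1_norm p (f k)
        \<le> l2_norm n (Gamma_map n p Y (f k)) / sqrt (real n)"
  shows "l2_norm p x / 4 - D * l1_norm p x \<le> l2_norm n (Gamma_map n p Y x) / sqrt (real n)"
proof (rule LIMSEQ_le)
  show "(\<lambda>k. l2_norm p (f k) / 4 - D * l1_norm p (f k)) \<longlonglongrightarrow> l2_norm p x / 4 - D * l1_norm p x"
    unfolding l2_norm_def L2_set_def l1_norm_def divide_inverse by (intro tendsto_intros lim)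
  show "(\<lambda>k. l2_norm n (Gamma_map n p Y (f k)) / sqrt (real n))
      \<longlonglongrightarrow> l2_norm n (Gamma_map n p Y x) / sqrt (real n)"
    unfolding l2_norm_Gamma_map dotp_def divide_inverse by (intro tendsto_intros lim)
qed (use ineq in auto)

lemma ex_rational_sequence:
  fixes x :: "nat \<Rightarrow> real"
  shows "\<exists>f. (\<forall>k. f k \<in> (\<Pi>\<^sub>E j\<in>{1..p}. \<rat>)) \<and> (\<forall>j\<in>{1..p}. (\<lambda>k. f k j) \<longlonglongrightarrow> x j)"
proof -
  have "\<exists>g. (\<forall>k. g k \<in> \<rat>) \<and> g \<longlonglongrightarrow> x j" for j
    using closure_sequential[of "x j" \<rat>] Rats_closure_real by auto
  then obtain g where g: "\<And>j k. g j k \<in> \<rat>" "\<And>j. g j \<longlonglongrightarrow> x j"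
    by metis
  show ?thesis
    by (rule exI[of _ "\<lambda>k. \<lambda>j\<in>{1..p}. g j k"]) (use g in auto)
qed

text \<open>
  The event is an uncountable intersection; by continuity in \<open>x\<close> it suffices to intersect over
  rational vectors. Without this its \<^const>\<open>measure\<close> could be the junk value \<open>0\<close>.
\<close>

lemma sets_l2_l1_bound:
  assumes X: "\<And>i. i \<in> {1..n} \<Longrightarrow> X i \<in> M \<rightarrow>\<^sub>M Rvec p"
  shows "{\<omega> \<in> space M. \<forall>x\<in>space (Rvec p). l2_norm p x / 4 - D * l1_norm p x
      \<le> l2_norm n (Gamma_map n p (\<lambda>i. X i \<omega>) x) / sqrt (real n)} \<in> sets M"
proof -
  note [measurable] = X
  let ?R = "\<Pi>\<^sub>E j\<in>{1..p}. (\<rat> :: real set)"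
  let ?F = "\<lambda>\<omega> x. l2_norm p x / 4 - D * l1_norm p x
      \<le> l2_norm n (Gamma_map n p (\<lambda>i. X i \<omega>) x) / sqrt (real n)"
  have R: "countable ?R"
    by (intro countable_PiE countable_rat) simp
  have "(\<forall>x\<in>space (Rvec p). ?F \<omega> x) \<longleftrightarrow> (\<forall>x\<in>?R. ?F \<omega> x)" for \<omega>
  proof
    assume "\<forall>x\<in>space (Rvec p). ?F \<omega> x"
    moreover have "?R \<subseteq> space (Rvec p)"
      by (auto simp: space_PiM PiE_def)
    ultimately show "\<forall>x\<in>?R. ?F \<omega> x" by blast
  next
    assume rat: "\<forall>x\<in>?R. ?F \<omega> x"
    show "\<forall>x\<in>space (Rvec p). ?F \<omega> x"
    proof
      fix x :: "nat \<Rightarrow> real"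
      from ex_rational_sequence[of p x] obtain f
        where f: "\<And>k. f k \<in> ?R" "\<And>j. j \<in> {1..p} \<Longrightarrow> (\<lambda>k. f k j) \<longlonglongrightarrow> x j"
        by blast
      show "?F \<omega> x"
        by (rule l2_l1_bound_limit[OF f(2)]) (use rat f(1) in blast)+
    qed
  qed
  then have "{\<omega> \<in> space M. \<forall>x\<in>space (Rvec p). ?F \<omega> x} = {\<omega> \<in> space M. \<forall>x\<in>?R. ?F \<omega> x}"
    by simp
  also have "\<dots> \<in> sets M"
    unfolding l2_norm_Gamma_map by (rule sets.sets_Collect_countable_All'[OF _ R]) measurable
  finally show ?thesis .
qed

section \<open>The three regimes of \<open>p\<close> and the final estimate\<close>

lemma l2_norm_le_l1_norm: "l2_norm p x \<le> l1_norm p x"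
  unfolding l2_norm_def l1_norm_def by (rule L2_set_le_sum_abs)

text \<open>The rate \<open>c''\<close> is a function of \<alpha>, since no single positive rate
  serves all \<alpha>: for p = 1, a variable that is 0 with probability 1 - d and otherwise has
  square 1/d makes \<Gamma> vanish with probability (1 - d)^n, and the inequality then fails at x =
  1 because ln 1 = 0.\<close>

theorem theorem3:
  "\<exists>c'>0. \<exists>(c'' :: real \<Rightarrow> real) (C :: real \<Rightarrow> real).
     (\<forall>\<alpha>\<ge>1. c'' \<alpha> > 0 \<and> C \<alpha> > 0) \<and>
     (\<forall>(n::nat) (p::nat) (\<alpha>::real) (\<mu> :: (nat \<Rightarrow> real) measure)
        (M :: (nat \<Rightarrow> nat \<Rightarrow> real) measure)
        (X :: nat \<Rightarrow> (nat \<Rightarrow> nat \<Rightarrow> real) \<Rightarrow> nat \<Rightarrow> real).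
        n \<ge> 1 \<longrightarrow> p \<ge> 1 \<longrightarrow> \<alpha> \<ge> 1 \<longrightarrow>
        prob_space \<mu> \<longrightarrow> sets \<mu> = sets (Rvec p) \<longrightarrow>
        isotropic p \<mu> \<longrightarrow> psi2_with_const p \<alpha> \<mu> \<longrightarrow>
        iid_sample n p \<mu> M X \<longrightarrow>
        measure M {\<omega> \<in> space M. \<forall>x\<in>space (Rvec p).
            l2_norm p x / 4 - C \<alpha> * sqrt (ln (real p) / real n) * l1_norm p x
              \<le> l2_norm n (Gamma_map n p (\<lambda>i. X i \<omega>) x) / sqrt (real n)}
          \<ge> 1 - c' * exp (- c'' \<alpha> * real n))"
proof (rule exI[of _ 2], intro conjI, simp, rule exI[of _ "\<lambda>\<alpha>. 1 / (512 * \<alpha>^4)"],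
    rule exI[of _ "\<lambda>\<alpha>. 200 * \<alpha>^3"], intro conjI allI impI)
  fix n p :: nat and \<alpha> :: real and \<mu> :: "(nat \<Rightarrow> real) measure"
    and M :: "(nat \<Rightarrow> nat \<Rightarrow> real) measure" and X :: "nat \<Rightarrow> (nat \<Rightarrow> nat \<Rightarrow> real) \<Rightarrow> nat \<Rightarrow> real"
  assume n: "n \<ge> 1" and p: "p \<ge> 1" and \<alpha>: "\<alpha> \<ge> 1"
    and \<mu>: "prob_space \<mu>" "sets \<mu> = sets (Rvec p)" "isotropic p \<mu>" "psi2_with_const p \<alpha> \<mu>"
    and iid: "iid_sample n p \<mu> M X"
  interpret prob_space M
    using iid by (simp add: iid_sample_def)
  note X[measurable] = iid_sample_measurable[OF iid]
  define L where "L = ln (real p)"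
  \<comment> \<open>The constant 200 is chosen so that its square 40000 exceeds the 32768 that
    arises in the main regime.\<close>
  define D where "D = 200 * \<alpha>^3 * sqrt (L / real n)"
  define \<kappa> where "\<kappa> = 1 / (256 * \<alpha>^4)"
  define P where "P \<omega> \<longleftrightarrow> (\<forall>x\<in>space (Rvec p). l2_norm p x / 4 - D * l1_norm p x
      \<le> l2_norm n (Gamma_map n p (\<lambda>i. X i \<omega>) x) / sqrt (real n))" for \<omega>
  have E: "{\<omega> \<in> space M. P \<omega>} \<in> sets M"
    unfolding P_def by (rule sets_l2_l1_bound[OF X])
  have "0 \<le> L" using p by (simp add: L_def)
  have "0 \<le> D" using \<alpha> \<open>0 \<le> L\<close> by (simp add: D_def)
  have "1 \<le> \<alpha>^4" using \<alpha> by simp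
  have "0 < \<kappa>" using \<alpha> by (simp add: \<kappa>_def)
  have "\<kappa> \<le> 1 / 256" unfolding \<kappa>_def using \<open>1 \<le> \<alpha>^4\<close> by (intro frac_le) auto
  have D2: "D\<^sup>2 = 40000 * \<alpha>^6 * (L / real n)"
    using \<open>0 \<le> L\<close> by (simp add: D_def power_mult_distrib flip: power_mult)
  have "p = 1 \<or> p \<ge> 2" using p by linarith
  moreover have "\<kappa> * real n < 8 * L \<or> 8 * L \<le> \<kappa> * real n" by linarith
  \<comment> \<open>For \<open>p = 1\<close> the logarithm vanishes, so \<open>D = 0\<close> and no
    number of summands of order \<open>\<kappa> * n / L\<close> exists. For \<open>p \<ge> 2\<close>
    the question is whether that number reaches 2.\<close>
  ultimately consider "p = 1" | "p \<ge> 2" "\<kappa> * real n < 8 * L" | "p \<ge> 2" "8 * L \<le> \<kappa> * real n"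
    by blast
  then have "1 - 2 * exp (- (\<kappa> / 2) * real n) \<le> measure M {\<omega> \<in> space M. P \<omega>}"
  proof cases
    case 1
    let ?B = "{\<omega> \<in> space M. quad_gap n p (\<lambda>i. X i \<omega>) (signed_unit 1 1) < 0}"
    have "{\<omega> \<in> space M. \<not> P \<omega>} \<subseteq> ?B"
    proof (rule subsetI, rule ccontr)
      fix \<omega> assume \<omega>: "\<omega> \<in> {\<omega> \<in> space M. \<not> P \<omega>}" and "\<omega> \<notin> ?B"
      then have pos: "0 \<le> quad_gap n p (\<lambda>i. X i \<omega>) (signed_unit 1 1)"
        by auto
      \<comment> \<open>In dimension one all vectors are multiples of a single one, so one tail
        bound controls every \<open>x\<close>.\<close>
      have scale: "quad_gap n p Y x = (x 1)\<^sup>2 * quad_gap n p Y (signed_unit 1 1)" for Y x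
        unfolding quad_gap_scale[symmetric] using 1
        by (simp add: quad_gap_def dotp_def signed_unit_def)
      have gap: "0 \<le> quad_gap n p (\<lambda>i. X i \<omega>) x" for x
        unfolding scale[of _ x] using pos by (intro mult_nonneg_nonneg) simp_all
      have "- D\<^sup>2 * (l1_norm p x)\<^sup>2 \<le> quad_gap n p (\<lambda>i. X i \<omega>) x" for x
        by (rule order_trans[OF _ gap]) simp
      then have "P \<omega>"
        unfolding P_def using \<open>0 \<le> D\<close> by (blast intro: l2_norm_bound_of_quad_gap)
      with \<omega> show False by simp
    qed
    then have "measure M {\<omega> \<in> space M. \<not> P \<omega>} \<le> measure M ?B"
      by (rule finite_measure_mono) (unfold quad_gap_def, measurable)
    also have "\<dots> \<le> exp (- real n / (256 * \<alpha>^4))"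
      by (rule prob_quad_gap_neg[OF iid \<mu> \<alpha> n])
    also have "\<dots> \<le> exp (- (\<kappa> / 2) * real n)"
      using \<alpha> by (simp add: \<kappa>_def field_simps)
    also have "\<dots> \<le> 2 * exp (- (\<kappa> / 2) * real n)"
      by simp
    finally show ?thesis
      using prob_neg[OF E] by simp
  next
    case 2
    \<comment> \<open>This makes the left-hand side nonpositive for every \<open>x\<close>, so
      \<open>P\<close> holds at every sample point.\<close>
    have "1 / 4 \<le> D"
    proof (rule power2_le_imp_le)
      have "\<kappa> / 8 \<le> L / real n"
        using 2 n by (simp add: field_simps)
      then have "40000 * \<alpha>^6 * (\<kappa> / 8) \<le> D\<^sup>2"
        unfolding D2 using \<alpha> by (intro mult_left_mono) auto
      moreover have "40000 * \<alpha>^6 * (\<kappa> / 8) = 40000 / 2048 * \<alpha>\<^sup>2"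
        using \<alpha> by (simp add: \<kappa>_def field_simps flip: power_add)
      moreover have "1 \<le> \<alpha>\<^sup>2" using \<alpha> by simp
      ultimately show "(1 / 4)\<^sup>2 \<le> D\<^sup>2" by (simp add: power_divide)
    qed fact
    have "l2_norm p x / 4 - D * l1_norm p x \<le> l2_norm n (Gamma_map n p Y x) / sqrt (real n)" for Y x
    proof -
      have "l2_norm p x / 4 \<le> 1 / 4 * l1_norm p x"
        using l2_norm_le_l1_norm[of p x] by simp
      also have "\<dots> \<le> D * l1_norm p x"
        using \<open>1 / 4 \<le> D\<close> l1_norm_nonneg by (rule mult_right_mono)
      finally have "l2_norm p x / 4 - D * l1_norm p x \<le> 0" by simp
      also have "0 \<le> l2_norm n (Gamma_map n p Y x) / sqrt (real n)"
        by (simp add: l2_norm_def L2_set_nonneg)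
      finally show ?thesis .
    qed
    then have "P \<omega>" for \<omega>
      by (simp add: P_def)
    then show ?thesis
      by (simp add: prob_space)
  next
    case 3
    have "ln 2 \<le> L"
      using 3 by (simp add: L_def)
    then have "0 < L"
      using ln_gt_zero[of "2::real"] by linarith
    \<comment> \<open>As \<open>ln 2 \<le> L\<close>, the count \<open>(2 * p)^m\<close> is at most
      \<open>exp (2 * L * r) = exp (\<kappa> * n / 2)\<close>, which uses up half of the exponent in
      the tail bound. The case assumption says \<open>r \<ge> 2\<close>, so rounding down loses at
      most a factor 2.\<close>
    define r where "r = \<kappa> * real n / (4 * L)"
    define m where "m = nat \<lfloor>r\<rfloor>"
    have "2 \<le> r"
      using 3 \<open>0 < L\<close> by (simp add: r_def field_simps)
    then have m2: "m \<ge> 2" and m_le: "real m \<le> r" and m_ge: "r / 2 \<le> real m"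
      unfolding m_def by linarith+
    have "16 * \<alpha>\<^sup>2 / real m \<le> 16 * \<alpha>\<^sup>2 / (r / 2)"
      using m_ge \<open>2 \<le> r\<close> by (intro divide_left_mono) auto
    also have "\<dots> = 32768 * \<alpha>^6 * (L / real n)"
      using \<alpha> n \<open>0 < L\<close> by (simp add: r_def \<kappa>_def field_simps flip: power_add)
    also have "\<dots> \<le> D\<^sup>2"
      unfolding D2 using \<open>0 < L\<close> \<alpha> by (intro mult_right_mono) auto
    finally have mD: "16 * \<alpha>\<^sup>2 / real m \<le> D\<^sup>2" .
    have "1 - ((2 * real p) ^ m * exp (- real n / (256 * \<alpha>^4)) + real p * exp (- real n))
        \<le> measure M {\<omega> \<in> space M. P \<omega>}"
    proof (rule prob_ge_of_quad_gap_lower_bound[OF iid \<mu> \<alpha> n m2 E])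
      fix \<omega>
      assume gap: "\<And>x. - (16 * \<alpha>\<^sup>2 / real m) * (l1_norm p x)\<^sup>2 \<le> quad_gap n p (\<lambda>i. X i \<omega>) x"
      have "- D\<^sup>2 * (l1_norm p x)\<^sup>2 \<le> - (16 * \<alpha>\<^sup>2 / real m) * (l1_norm p x)\<^sup>2" for x
        using mD by (intro mult_right_mono) auto
      from order_trans[OF this gap] show "P \<omega>"
        unfolding P_def using \<open>0 \<le> D\<close> by (blast intro: l2_norm_bound_of_quad_gap)
    qed
    \<comment> \<open>Each of the two failure terms is at most
      \<open>exp (- (\<kappa> / 2) * n)\<close>, which gives \<open>c' = 2\<close>.\<close>
    moreover have "(2 * real p) ^ m * exp (- real n / (256 * \<alpha>^4)) \<le> exp (- (\<kappa> / 2) * real n)"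
    proof -
      have "(2 * real p) ^ m = exp (real m * (ln 2 + L))"
        using p by (simp add: exp_of_nat_mult exp_add L_def)
      also have "\<dots> \<le> exp (r * (2 * L))"
        using m_le \<open>ln 2 \<le> L\<close> \<open>0 < L\<close> \<open>2 \<le> r\<close>
        by (intro exp_le_cancel_iff[THEN iffD2] mult_mono) auto
      also have "r * (2 * L) = \<kappa> / 2 * real n"
        using \<open>0 < L\<close> by (simp add: r_def)
      finally have "(2 * real p) ^ m * exp (- real n / (256 * \<alpha>^4))
          \<le> exp (\<kappa> / 2 * real n) * exp (- \<kappa> * real n)"
        by (simp add: \<kappa>_def)
      also have "\<dots> = exp (- (\<kappa> / 2) * real n)"
        by (simp add: exp_add[symmetric])
      finally show ?thesis .
    qed
    moreover have "real p * exp (- real n) \<le> exp (- (\<kappa> / 2) * real n)"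
    proof -
      have "real p * exp (- real n) = exp (L - real n)"
        using p by (simp add: exp_diff exp_minus L_def field_simps)
      also have "L - real n \<le> \<kappa> / 8 * real n - real n"
        using 3 by simp
      also have "\<dots> = (\<kappa> / 8 - 1) * real n"
        by (simp add: algebra_simps)
      also have "\<dots> \<le> - (\<kappa> / 2) * real n"
        using \<open>\<kappa> \<le> 1 / 256\<close> by (intro mult_right_mono) auto
      finally show ?thesis by simp
    qed
    ultimately show ?thesis by linarith
  qed
  then show "1 - 2 * exp (- (1 / (512 * \<alpha>^4)) * real n) \<le>
    measure M {\<omega> \<in> space M. \<forall>x\<in>space (Rvec p).
      l2_norm p x / 4 - 200 * \<alpha>^3 * sqrt (ln (real p) / real n) * l1_norm p x
        \<le> l2_norm n (Gamma_map n p (\<lambda>i. X i \<omega>) x) / sqrt (real n)}"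
    by (simp add: P_def D_def L_def \<kappa>_def)
qed auto

end
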